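(* Let $q\ge 3$ be a prime power and let $X\subset\mathbb{P}^3(\mathbb{F}_q)$ be a quadric cone. The second and third weights of the code $C_2(X)$ are respectively $$w_2=q(q-2),\qquad w_3=(q-1)^2.$$
   Context: A quadric in $\mathbb{P}^3(\mathbb{F}_q)$ is the zero set $Z(f)$ of a nonzero form $f$ of degree 2 in $x_0,\dots,x_3$ over $\mathbb{F}_q$; its rank is the smallest number of indeterminates appearing in $f$ under any linear change of coordinates. A quadric cone is a quadric of rank 3. Let $F$ be the $\mathbb{F}_q$-vector space of forms of degree 2 in $x_0,\dots,x_3$ over $\mathbb{F}_q$ (including $0$). Each point $x\in\mathbb{P}^3(\mathbb{F}_q)$ is represented by its unique homogeneous coordinate vector whose first nonzero coordinate equals $1$. The functional code $C_2(X)$ is the image of the linear map $c:F\to\mathbb{F}_q^{|X|}$, $c(f)=(f(x_0,\dots,x_3))_{x\in X}$. The weight of a codeword is its number of nonzero coordinates. The weights are listed in increasing order: the first weight is the minimum distance, which for this code is stated by the paper to be $q(q-3)$; the second and third weights are the next two smallest weights of codewords.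
   Formalization: The first weight q(q-3) is the minimum distance only for q>3; for q=3 it is 0 (the minimum distance is then 3), so there the second and third weights are counted from the weight 0 of the zero codeword. *)

theory Defs
  imports "HOL-Analysis.Analysis" "HOL-Library.FuncSet"
begin

text \<open>The field with \<open>q\<close> elements is a type \<open>'a :: {field, finite}\<close> with \<open>CARD('a) = q\<close>.
The indeterminates \<open>x\<^sub>0, \<dots>, x\<^sub>3\<close> are indexed by the type \<open>4\<close>, whose elements are
\<open>0 < 1 < 2 < 3\<close>.  A form of degree 2 is given by its coefficients: the entry \<open>(i, j)\<close> of an
upper triangular matrix is the coefficient of \<open>x\<^sub>i x\<^sub>j\<close>, where \<open>i \<le> j\<close>.  Forms are
thus polynomials, not the functions they induce.\<close>

definition quadratic_forms :: "('a::field ^ 4 ^ 4) set" where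
  "quadratic_forms = {M. \<forall>i j. j < i \<longrightarrow> M $ i $ j = 0}"

definition form_eval :: "'a::field ^ 4 ^ 4 \<Rightarrow> 'a ^ 4 \<Rightarrow> 'a" where
  "form_eval M x = (\<Sum>i\<in>UNIV. \<Sum>j\<in>UNIV. M $ i $ j * x $ i * x $ j)"

text \<open>The form \<open>f(A x)\<close>: its expression as a bilinear expression in \<open>x\<close> has the matrix
\<open>transpose A ** M ** A\<close>, and the coefficients of \<open>x\<^sub>i x\<^sub>j\<close> and \<open>x\<^sub>j x\<^sub>i\<close> are
collected into the upper triangle (valid in every characteristic).\<close>

definition change_coords :: "'a::field ^ 4 ^ 4 \<Rightarrow> 'a ^ 4 ^ 4 \<Rightarrow> 'a ^ 4 ^ 4" where
  "change_coords A M =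
     (let N = transpose A ** M ** A
      in \<chi> i j. if i < j then N $ i $ j + N $ j $ i else if i = j then N $ i $ i else 0)"

definition indets :: "'a::field ^ 4 ^ 4 \<Rightarrow> 4 set" where
  "indets M = {i. \<exists>j. M $ i $ j \<noteq> 0 \<or> M $ j $ i \<noteq> 0}"

definition form_rank :: "'a::field ^ 4 ^ 4 \<Rightarrow> nat" where
  "form_rank M = (LEAST n. \<exists>A. invertible A \<and> card (indets (change_coords A M)) = n)"

text \<open>Points of projective 3-space, each represented by its homogeneous coordinate vector whose
first nonzero coordinate is 1.\<close>

definition proj_points :: "('a::field ^ 4) set" where
  "proj_points = {x. \<exists>i. x $ i = 1 \<and> (\<forall>j<i. x $ j = 0)}"

definition zero_set :: "'a::field ^ 4 ^ 4 \<Rightarrow> ('a ^ 4) set" where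
  "zero_set f = {x \<in> proj_points. form_eval f x = 0}"

definition quadric_cone :: "('a::field ^ 4) set \<Rightarrow> bool" where
  "quadric_cone X \<longleftrightarrow>
     (\<exists>f \<in> quadratic_forms. f \<noteq> 0 \<and> form_rank f = 3 \<and> X = zero_set f)"

text \<open>Words with coordinates indexed by \<open>X\<close> are the elements of \<open>X \<rightarrow>\<^sub>E UNIV\<close>.\<close>

definition functional_code :: "('a::field ^ 4) set \<Rightarrow> ('a ^ 4 \<Rightarrow> 'a) set" where
  "functional_code X = (\<lambda>f. restrict (form_eval f) X) ` quadratic_forms"

definition weight :: "'b set \<Rightarrow> ('b \<Rightarrow> 'a::zero) \<Rightarrow> nat" where
  "weight X v = card {x \<in> X. v x \<noteq> 0}"

definition hamming_dist :: "'b set \<Rightarrow> ('b \<Rightarrow> 'a) \<Rightarrow> ('b \<Rightarrow> 'a) \<Rightarrow> nat" where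
  "hamming_dist X u v = card {x \<in> X. u x \<noteq> v x}"

definition min_distance :: "'b set \<Rightarrow> ('b \<Rightarrow> 'a) set \<Rightarrow> nat" where
  "min_distance X C = (LEAST d. \<exists>u\<in>C. \<exists>v\<in>C. u \<noteq> v \<and> hamming_dist X u v = d)"

text \<open>\<open>w\<close> comes directly after \<open>v\<close> in the increasing list of the weights of the codewords
(the zero word included).  For a quadric cone and \<open>q = 3\<close>, the first weight \<open>q (q - 3)\<close> is \<open>0\<close>: it
is the minimum distance only for \<open>q > 3\<close>.\<close>

definition next_weight :: "'b set \<Rightarrow> ('b \<Rightarrow> 'a::zero) set \<Rightarrow> nat \<Rightarrow> nat \<Rightarrow> bool" where
  "next_weight X C v w \<longleftrightarrow>
     v \<in> weight X ` C \<and> w \<in> weight X ` C \<and> v < w \<and>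
     (\<forall>u \<in> weight X ` C. \<not> (v < u \<and> u < w))"

end

theory Submission
  imports Defs "HOL-Computational_Algebra.Polynomial"
begin

text \<open>A form of rank 3 has, up to scalars, exactly one null vector (the vertex). By
Chevalley--Warning it also has an isotropic vector off the vertex line; completing this to a
hyperbolic plane gives coordinates in which the form is a multiple of \<open>x\<^sub>1 x\<^sub>3 - x\<^sub>2\<^sup>2\<close>, in every
characteristic. The cone is then a family of \<open>q + 1\<close> lines through the vertex, indexed by the points
\<open>t\<close> of a projective line, on which a second form restricts to \<open>c w\<^sup>2 + L(t) w + Q(t)\<close>, with
\<open>L\<close> of degree 2 and \<open>Q\<close> of degree 4. Counting nonzeros line by line shows that every weight is
at least \<open>(q - 1)\<^sup>2\<close> unless \<open>c = 0\<close>, \<open>L = 0\<close>, where it is \<open>0\<close> or \<open>q (q + 1 - k)\<close> with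
\<open>k \<le> 4\<close> the number of zeros of \<open>Q\<close>.\<close>

section \<open>Power sums over a finite field and Chevalley--Warning\<close>

lemma finite_field_power_card_minus_1:
  fixes x :: "'a::{field, finite}"
  assumes "x \<noteq> 0"
  shows "x ^ (CARD('a) - 1) = 1"
proof -
  let ?U = "UNIV - {0::'a}"
  have "bij_betw ((*) x) ?U ?U"
    by (rule bij_betwI[where g = "\<lambda>y. y / x"]) (use assms in auto)
  then have "prod (\<lambda>y. x * y) ?U = prod (\<lambda>y. y) ?U"
    by (rule prod.reindex_bij_betw)
  then have "x ^ card ?U * \<Prod>?U = \<Prod>?U"
    by (simp add: prod.distrib)
  moreover have "\<Prod>?U \<noteq> 0" by simp
  ultimately show ?thesis by (simp add: card_Diff_singleton)
qed

text \<open>Substituting \<open>a * x\<close> for \<open>x\<close> multiplies the sum by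
  \<open>a ^ i\<close>. Since \<open>x ^ i - 1\<close> has at most \<open>i\<close> roots, some
  nonzero \<open>a\<close> has \<open>a ^ i \<noteq> 1\<close>. For \<open>i = 0\<close> the sum
  counts the field, and translation by \<open>1\<close> shows that this count vanishes.\<close>

lemma sum_powers_finite_field:
  assumes "i < CARD('a::{field, finite}) - 1"
  shows "(\<Sum>x\<in>UNIV. (x::'a) ^ i) = 0"
proof (cases "i = 0")
  case True
  have "bij_betw (\<lambda>x::'a. x + 1) UNIV UNIV"
    by (rule bij_betwI[where g = "\<lambda>y. y - 1"]) auto
  then have "(\<Sum>x\<in>UNIV. x + (1::'a)) = (\<Sum>x\<in>UNIV. x)"
    by (rule sum.reindex_bij_betw)
  then show ?thesis using True by (simp add: sum.distrib)
next
  case False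
  let ?p = "monom (1::'a) i - 1"
  have c0: "coeff ?p i = 1" using False by (simp add: coeff_1)
  then have "?p \<noteq> 0" by fastforce
  then have "card {x. poly ?p x = 0} \<le> degree ?p" by (rule card_poly_roots_bound)
  also have "\<dots> \<le> i" by (intro degree_diff_le) (auto simp: degree_monom_eq)
  also have "i < card (UNIV - {0::'a})" using assms by (simp add: card_Diff_singleton)
  finally have "\<not> UNIV - {0::'a} \<subseteq> {x. poly ?p x = 0}"
    by (meson card_mono finite not_less)
  then obtain a :: 'a where a: "a \<noteq> 0" "a ^ i \<noteq> 1"
    by (auto simp: poly_monom)
  have "bij_betw ((*) a) UNIV UNIV"
    by (rule bij_betwI[where g = "\<lambda>y. y / a"]) (use a in auto)
  then have "(\<Sum>x\<in>UNIV. (a * x) ^ i) = (\<Sum>x\<in>UNIV. x ^ i)"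
    by (rule sum.reindex_bij_betw)
  then have "a ^ i * (\<Sum>x\<in>UNIV. x ^ i) = (\<Sum>x\<in>UNIV. x ^ i)"
    by (simp add: power_mult_distrib sum_distrib_left)
  then show ?thesis using a by simp
qed

text \<open>Polynomial functions in three variables of total degree at most \<open>d\<close>. The
  inductive form reduces sums over all points to the case of a monomial.\<close>

inductive poly_fun3 :: "nat \<Rightarrow> ('a::field \<times> 'a \<times> 'a \<Rightarrow> 'a) \<Rightarrow> bool" where
  monom: "i + j + k \<le> d \<Longrightarrow> poly_fun3 d (\<lambda>(x, y, z). c * x ^ i * y ^ j * z ^ k)"
| add: "poly_fun3 d g \<Longrightarrow> poly_fun3 d h \<Longrightarrow> poly_fun3 d (\<lambda>p. g p + h p)"

lemma poly_fun3_mult: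
  assumes "poly_fun3 d g" "poly_fun3 e h"
  shows "poly_fun3 (d + e) (\<lambda>p. g p * h p)"
  using assms(1)
proof induction
  case (monom i j k d c)
  show ?case using assms(2)
  proof induction
    case (monom i' j' k' e c')
    have "(\<lambda>p. (case p of (x, y, z) \<Rightarrow> c * x ^ i * y ^ j * z ^ k) *
               (case p of (x, y, z) \<Rightarrow> c' * x ^ i' * y ^ j' * z ^ k'))
        = (\<lambda>(x, y, z). (c * c') * x ^ (i + i') * y ^ (j + j') * z ^ (k + k'))"
      by (auto simp: fun_eq_iff power_add)
    then show ?case
      using poly_fun3.monom[of "i + i'" "j + j'" "k + k'" "d + e" "c * c'"] monom
        \<open>i + j + k \<le> d\<close> by simp
  next
    case (add e g h)
    then show ?case using poly_fun3.add[OF add.IH] by (simp add: distrib_left)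
  qed
next
  case (add d g g')
  then show ?case using poly_fun3.add[OF add.IH] by (simp add: distrib_right)
qed

lemma poly_fun3_power:
  assumes "poly_fun3 d g"
  shows "poly_fun3 (n * d) (\<lambda>p. g p ^ n)"
proof (induction n)
  case 0
  show ?case using poly_fun3.monom[of 0 0 0 0 1] by (simp add: case_prod_unfold)
next
  case (Suc n)
  show ?case using poly_fun3_mult[OF assms Suc] by simp
qed

text \<open>The sum of a monomial factors into three power sums, and the degree bound forces one of
  the exponents below \<open>q - 1\<close>.\<close>

lemma sum_poly_fun3:
  fixes g :: "'a::{field, finite} \<times> 'a \<times> 'a \<Rightarrow> 'a"
  assumes "poly_fun3 d g" "d < 3 * (CARD('a) - 1)"
  shows "(\<Sum>p\<in>UNIV. g p) = 0"
  using assms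
proof induction
  case (monom i j k d c)
  let ?s = "\<lambda>n. \<Sum>x\<in>(UNIV::'a set). x ^ n"
  have "(\<Sum>p\<in>UNIV. case p of (x, y, z) \<Rightarrow> c * x ^ i * y ^ j * z ^ k)
      = (\<Sum>x\<in>UNIV. \<Sum>y\<in>UNIV. \<Sum>z\<in>UNIV. c * x ^ i * y ^ j * z ^ k)"
    by (simp flip: UNIV_Times_UNIV add: sum.cartesian_product)
  also have "\<dots> = c * ?s i * ?s j * ?s k"
    by (simp add: sum_distrib_left sum_distrib_right mult_ac)
  also have "\<dots> = 0"
  proof -
    from monom have "i < CARD('a) - 1 \<or> j < CARD('a) - 1 \<or> k < CARD('a) - 1" by linarith
    then show ?thesis by (auto simp: sum_powers_finite_field)
  qed
  finally show ?case .
qed (simp add: sum.distrib)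

text \<open>Chevalley--Warning: summing \<open>1 - g\<^bsup>q - 1\<^esup>\<close> over all points counts the zeros of \<open>g\<close> modulo
the characteristic, while \<open>2 (q - 1) < 3 (q - 1)\<close> makes the sum vanish.\<close>

lemma ternary_quadratic_isotropic:
  fixes a b c d e h :: "'a::{field, finite}"
  obtains x y z where "(x, y, z) \<noteq> (0, 0, 0)"
    "a * x\<^sup>2 + b * y\<^sup>2 + c * z\<^sup>2 + d * x * y + e * x * z + h * y * z = 0"
proof -
  define g :: "'a \<times> 'a \<times> 'a \<Rightarrow> 'a" where
    "g = (\<lambda>(x, y, z). a * x\<^sup>2 + b * y\<^sup>2 + c * z\<^sup>2 + d * x * y + e * x * z + h * y * z)"
  have pos: "0 < CARD('a) - 1"
    using card_mono[of UNIV "{0, 1::'a}"] by simp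
  note mon = poly_fun3.monom[where d = 2]
  note ad = poly_fun3.add
  have "poly_fun3 2 g"
    using ad[OF ad[OF ad[OF ad[OF ad[OF mon[of 2 0 0 a] mon[of 0 2 0 b]] mon[of 0 0 2 c]]
        mon[of 1 1 0 d]] mon[of 1 0 1 e]] mon[of 0 1 1 h]]
    by (simp add: g_def case_prod_unfold)
  then have "(\<Sum>p\<in>UNIV. g p ^ (CARD('a) - 1)) = 0"
    using sum_poly_fun3[OF poly_fun3_power[of 2 g "CARD('a) - 1"]] pos by simp
  moreover have "(\<Sum>p\<in>(UNIV :: ('a \<times> 'a \<times> 'a) set). 1::'a) = 0"
    using sum_poly_fun3[OF poly_fun3.monom[of 0 0 0 0 "1::'a"]] pos
    by (simp add: case_prod_unfold)
  ultimately have 0: "(\<Sum>p\<in>UNIV. 1 - g p ^ (CARD('a) - 1)) = 0"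
    by (simp add: sum_subtractf)
  have "\<exists>p. p \<noteq> (0, 0, 0) \<and> g p = 0"
  proof (rule ccontr)
    assume nz: "\<nexists>p. p \<noteq> (0, 0, 0) \<and> g p = 0"
    \<comment> \<open>If the origin were the only zero, the summand would be its indicator function
      and the sum would be \<open>1\<close>.\<close>
    have "1 - g p ^ (CARD('a) - 1) = (if p = (0, 0, 0) then 1 else 0)" for p
    proof (cases "p = (0, 0, 0)")
      case True
      then have "g p = 0" by (simp add: g_def)
      with True pos show ?thesis by simp
    next
      case False
      with nz have "g p \<noteq> 0" by blast
      with False show ?thesis by (simp add: finite_field_power_card_minus_1 del: One_nat_def)
    qed
    with 0 show False by simp
  qed
  then show ?thesis using that by (auto simp: g_def)
qed

section \<open>Polar forms and coordinate changes\<close>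

definition bil :: "'a::field ^ 4 ^ 4 \<Rightarrow> 'a ^ 4 \<Rightarrow> 'a ^ 4 \<Rightarrow> 'a" where
  "bil M x y = (\<Sum>i\<in>UNIV. \<Sum>j\<in>UNIV. M $ i $ j * x $ i * y $ j)"

text \<open>The polarization \<open>f (x + y) - f x - f y\<close> of the quadratic form, written
  without division by \<open>2\<close> so that it serves characteristic 2 as well.\<close>

definition polar :: "'a::field ^ 4 ^ 4 \<Rightarrow> 'a ^ 4 \<Rightarrow> 'a ^ 4 \<Rightarrow> 'a" where
  "polar M x y = bil M x y + bil M y x"

text \<open>The direction of a vertex: adding such a vector never changes the value of the form. In
  characteristic 2 the polar condition alone does not make the form vanish at
  \<open>x\<close>.\<close>

definition null_vector :: "'a::field ^ 4 ^ 4 \<Rightarrow> 'a ^ 4 \<Rightarrow> bool" where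
  "null_vector M x \<longleftrightarrow> form_eval M x = 0 \<and> (\<forall>y. polar M x y = 0)"

lemma form_eval_bil: "form_eval M x = bil M x x"
  by (simp add: form_eval_def bil_def)

lemma bil_simps [simp]:
  "bil M (x + y) z = bil M x z + bil M y z"
  "bil M z (x + y) = bil M z x + bil M z y"
  "bil M (x - y) z = bil M x z - bil M y z"
  "bil M z (x - y) = bil M z x - bil M z y"
  "bil M (a *s x) z = a * bil M x z"
  "bil M z (a *s x) = a * bil M z x"
  "bil M 0 z = 0" "bil M z 0 = 0"
  by (simp_all add: bil_def algebra_simps sum.distrib sum_subtractf sum_distrib_left)

lemma polar_commute: "polar M x y = polar M y x"
  by (simp add: polar_def add.commute)

lemma polar_simps [simp]:
  "polar M (x + y) z = polar M x z + polar M y z"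
  "polar M z (x + y) = polar M z x + polar M z y"
  "polar M (x - y) z = polar M x z - polar M y z"
  "polar M z (x - y) = polar M z x - polar M z y"
  "polar M (a *s x) z = a * polar M x z"
  "polar M z (a *s x) = a * polar M z x"
  "polar M 0 z = 0" "polar M z 0 = 0"
  by (simp_all add: polar_def algebra_simps)

lemma polar_self: "polar M x x = 2 * form_eval M x"
  by (simp add: polar_def form_eval_bil)

lemma form_eval_add: "form_eval M (x + y) = form_eval M x + form_eval M y + polar M x y"
  by (simp add: polar_def form_eval_bil algebra_simps)

lemma form_eval_diff: "form_eval M (x - y) = form_eval M x + form_eval M y - polar M x y"
  by (simp add: polar_def form_eval_bil algebra_simps)

lemma form_eval_scale: "form_eval M (a *s x) = a\<^sup>2 * form_eval M x"
  by (simp add: form_eval_bil power2_eq_square)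

lemma bil_matrix_vector: "bil M x y = (\<Sum>i\<in>UNIV. x $ i * (M *v y) $ i)"
  by (simp add: bil_def matrix_vector_mult_def sum_distrib_left mult_ac)

lemma bil_congruence: "bil (transpose A ** M ** A) x y = bil M (A *v x) (A *v y)"
proof -
  define u where "u = M *v (A *v y)"
  have "bil (transpose A ** M ** A) x y = (\<Sum>i\<in>UNIV. x $ i * (transpose A *v u) $ i)"
    by (simp only: bil_matrix_vector u_def matrix_vector_mul_assoc matrix_mul_assoc)
  also have "\<dots> = (\<Sum>i\<in>UNIV. \<Sum>k\<in>UNIV. x $ i * (A $ k $ i * u $ k))"
    by (simp add: matrix_vector_mult_def transpose_def sum_distrib_left)
  also have "\<dots> = (\<Sum>k\<in>UNIV. \<Sum>i\<in>UNIV. x $ i * (A $ k $ i * u $ k))"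
    by (rule sum.swap)
  also have "\<dots> = (\<Sum>k\<in>UNIV. (A *v x) $ k * u $ k)"
    by (simp add: matrix_vector_mult_def sum_distrib_left sum_distrib_right mult_ac)
  finally show ?thesis by (simp add: bil_matrix_vector u_def)
qed

lemma matrix_vector_mult_axis: "A *v axis j 1 = column j A" for A :: "'a::field ^ 'n ^ 'm"
  by (simp add: vec_eq_iff matrix_vector_mult_def axis_def column_def
      if_distrib[of "\<lambda>c. _ * c"] cong: if_cong)

lemma bil_axis: "bil M (axis i 1) (axis j 1) = M $ i $ j"
proof -
  have "bil M (axis i 1) (axis j 1) = (\<Sum>k\<in>UNIV. if k = i then M $ k $ j else 0)"
    unfolding bil_matrix_vector matrix_vector_mult_axis
    by (intro sum.cong refl) (simp add: axis_def column_def)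
  then show ?thesis by simp
qed

lemma congruence_nth:
  "(transpose A ** M ** A) $ i $ j = bil M (column i A) (column j A)" for A :: "'a::field ^ 4 ^ 4"
  unfolding bil_axis[of "transpose A ** M ** A" i j, symmetric] bil_congruence
    matrix_vector_mult_axis ..

lemma change_coords_nth:
  "change_coords A M $ i $ j =
    (if i < j then polar M (column i A) (column j A)
     else if i = j then form_eval M (column i A) else 0)"
  by (simp add: change_coords_def Let_def congruence_nth polar_def form_eval_bil)

lemma form_eval_change_coords: "form_eval (change_coords A M) x = form_eval M (A *v x)"
proof -
  define N where "N = transpose A ** M ** A"
  let ?u = "\<lambda>i j. N $ i $ j * x $ i * x $ j"
  have "form_eval (change_coords A M) x =
    (\<Sum>i\<in>UNIV. \<Sum>j\<in>UNIV. (if i < j then ?u i j else 0) + (if i < j then ?u j i else 0)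
       + (if i = j then ?u i j else 0))"
    unfolding form_eval_def change_coords_def Let_def N_def
    by (intro sum.cong refl) (auto simp: algebra_simps)
  also have "\<dots> = (\<Sum>i\<in>UNIV. \<Sum>j\<in>UNIV. if i < j then ?u i j else 0)
      + (\<Sum>i\<in>UNIV. \<Sum>j\<in>UNIV. if i < j then ?u j i else 0)
      + (\<Sum>i\<in>UNIV. \<Sum>j\<in>UNIV. if i = j then ?u i j else 0)"
    by (simp only: sum.distrib)
  \<comment> \<open>Exchanging the indices moves the entries collected into the upper triangle back
    below the diagonal.\<close>
  also have "(\<Sum>i\<in>UNIV. \<Sum>j\<in>UNIV. if i < j then ?u j i else 0)
      = (\<Sum>i\<in>UNIV. \<Sum>j\<in>UNIV. if j < i then ?u i j else 0)"
    by (rule sum.swap)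
  also have "(\<Sum>i\<in>UNIV. \<Sum>j\<in>UNIV. if i < j then ?u i j else 0) + \<dots>
      + (\<Sum>i\<in>UNIV. \<Sum>j\<in>UNIV. if i = j then ?u i j else 0) = bil N x x"
    unfolding bil_def sum.distrib[symmetric]
    by (intro sum.cong refl) (auto simp: not_less_iff_gr_or_eq)
  finally show ?thesis by (simp add: N_def bil_congruence form_eval_bil)
qed

lemma change_coords_quadratic_forms: "change_coords A M \<in> quadratic_forms"
  by (auto simp: quadratic_forms_def change_coords_nth)

section \<open>Bases of the four-dimensional space\<close>

lemma exists_notin_span:
  fixes S :: "('a::field ^ 4) set"
  assumes "finite S" "card S < 4"
  obtains w where "w \<notin> vec.span S"
proof -
  have "vec.dim S < 4" using assms vec.dim_le_card'[of S] by linarith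
  moreover have "vec.dim (UNIV :: ('a ^ 4) set) = 4" by (subst vec_dim_card) simp
  ultimately have "vec.span S \<noteq> UNIV"
    using vec.dim_span[of S] by (metis less_irrefl)
  with that show ?thesis by blast
qed

text \<open>In the index type \<open>4\<close> the numeral \<open>4\<close> is \<open>0\<close>, so the last argument is the coordinate \<open>x\<^sub>0\<close>.\<close>

definition vec4 :: "'b \<Rightarrow> 'b \<Rightarrow> 'b \<Rightarrow> 'b \<Rightarrow> 'b ^ 4" where
  "vec4 a b c d = (\<chi> i. if i = 1 then a else if i = 2 then b else if i = 3 then c else d)"

lemma vec4_nth [simp]:
  "vec4 a b c d $ 1 = a" "vec4 a b c d $ 2 = b" "vec4 a b c d $ 3 = c" "vec4 a b c d $ 4 = d"
  by (simp_all add: vec4_def)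

definition cols4 :: "'a ^ 4 \<Rightarrow> 'a ^ 4 \<Rightarrow> 'a ^ 4 \<Rightarrow> 'a ^ 4 \<Rightarrow> 'a ^ 4 ^ 4" where
  "cols4 a b c d = (\<chi> i. vec4 (a $ i) (b $ i) (c $ i) (d $ i))"

lemma cols4_mult:
  "cols4 a b c d *v x = x $ 1 *s a + x $ 2 *s b + x $ 3 *s c + x $ 4 *s (d::'a::field ^ 4)"
  by (simp add: vec_eq_iff cols4_def matrix_vector_mult_def sum_4)

lemma column_cols4:
  "column 1 (cols4 a b c d) = a" "column 2 (cols4 a b c d) = b"
  "column 3 (cols4 a b c d) = c" "column 4 (cols4 a b c d) = d"
  by (simp_all add: vec_eq_iff cols4_def column_def)

lemma invertible_iff_kernel:
  "invertible A \<longleftrightarrow> (\<forall>x. A *v x = 0 \<longrightarrow> x = 0)" for A :: "'a::field ^ 'n ^ 'n"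
  by (metis invertible_def matrix_left_invertible_ker matrix_left_right_inverse)

lemma notin_span_coeff_zero:
  fixes S :: "('a::field ^ 'n) set"
  assumes "w \<notin> vec.span S" "s \<in> vec.span S" "s + a *s w = 0"
  shows "a = 0"
proof (rule ccontr)
  assume "a \<noteq> 0"
  moreover have "a *s w = - s" using assms(3) by (simp add: eq_neg_iff_add_eq_0 add.commute)
  ultimately have "w = inverse a *s (- s)" by (metis left_inverse vec.scale_one vec.scale_scale)
  then show False using assms(1,2) by (metis vec.span_neg vec.span_scale)
qed

lemma extend_pair_invertible:
  fixes z1 z2 :: "'a::field ^ 4"
  assumes ind: "\<And>a b. a *s z1 + b *s z2 = 0 \<Longrightarrow> a = 0 \<and> b = 0"
  obtains w1 w2 where "invertible (cols4 z1 z2 w1 w2)"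
proof -
  have "card {z1, z2} < 4" using card_insert_le_m1[of 2 "{z2}" z1] by simp
  then obtain w1 where w1: "w1 \<notin> vec.span {z1, z2}" using exists_notin_span[of "{z1, z2}"] by auto
  have "card {z1, z2, w1} < 4" by (simp add: card_insert_if)
  then obtain w2 where w2: "w2 \<notin> vec.span {z1, z2, w1}"
    using exists_notin_span[of "{z1, z2, w1}"] by auto
  have "x = 0" if "cols4 z1 z2 w1 w2 *v x = 0" for x
  proof -
    from that have eq: "(x $ 1 *s z1 + x $ 2 *s z2 + x $ 3 *s w1) + x $ 4 *s w2 = 0"
      by (simp add: cols4_mult)
    have "x $ 4 = 0"
      by (rule notin_span_coeff_zero[OF w2 _ eq])
        (intro vec.span_add vec.span_scale vec.span_base; simp)
    with eq have eq: "(x $ 1 *s z1 + x $ 2 *s z2) + x $ 3 *s w1 = 0" by simp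
    have "x $ 3 = 0"
      by (rule notin_span_coeff_zero[OF w1 _ eq])
        (intro vec.span_add vec.span_scale vec.span_base; simp)
    with eq ind[of "x $ 1" "x $ 2"] \<open>x $ 4 = 0\<close> show ?thesis
      by (simp add: vec_eq_iff forall_4)
  qed
  then show ?thesis by (intro that[of w1 w2]) (simp add: invertible_iff_kernel)
qed

section \<open>Null vectors and the rank\<close>

lemma polar_form_eval: "polar M x y = form_eval M (x + y) - form_eval M x - form_eval M y"
  by (simp add: form_eval_add)

text \<open>\<open>polar\<close> is a combination of values of the form, so it is transported
  together with them; surjectivity of \<open>A\<close> reaches every \<open>y\<close>.\<close>

lemma null_vector_change_coords:
  assumes "invertible A" "null_vector (change_coords A M) x"
  shows "null_vector M (A *v x)"
  unfolding null_vector_def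
proof (intro conjI allI)
  show "form_eval M (A *v x) = 0"
    using assms(2) by (simp add: null_vector_def flip: form_eval_change_coords)
  fix y
  obtain A' where "A ** A' = mat 1" using assms(1) by (auto simp: invertible_def)
  then have "y = A *v (A' *v y)" by (simp add: matrix_vector_mul_assoc)
  then show "polar M (A *v x) y = 0"
    using assms(2) unfolding null_vector_def polar_form_eval form_eval_change_coords
    by (metis matrix_vector_right_distrib)
qed

lemma null_vector_axis:
  assumes "i \<notin> indets M"
  shows "null_vector M (axis i 1)"
proof -
  have "bil M (axis i 1) y = 0" "bil M y (axis i 1) = 0" for y
    using assms unfolding bil_def by (auto intro!: sum.neutral simp: indets_def axis_def)
  then show ?thesis by (simp add: null_vector_def form_eval_bil polar_def)
qed

lemma form_rank_attained:
  obtains A where "invertible A" "card (indets (change_coords A M)) = form_rank M"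
proof -
  have "\<exists>n A. invertible A \<and> card (indets (change_coords A M)) = n"
    by (metis invertible_def matrix_mul_lid)
  from LeastI_ex[OF this] that show ?thesis by (auto simp: form_rank_def)
qed

text \<open>A shortest expression of the form omits an indeterminate. The corresponding basis vector
  is null there, and \<open>A\<close> carries it back to the original coordinates.\<close>

lemma null_vector_exists:
  assumes "form_rank M < 4"
  obtains z where "null_vector M z" "z \<noteq> 0"
proof -
  obtain A where A: "invertible A" "card (indets (change_coords A M)) = form_rank M"
    by (rule form_rank_attained)
  then have "indets (change_coords A M) \<noteq> UNIV" using assms by auto
  then obtain i where "i \<notin> indets (change_coords A M)" by blast
  then have "null_vector M (A *v axis i 1)"
    using A(1) by (intro null_vector_change_coords null_vector_axis)
  moreover have "A *v axis i 1 \<noteq> 0"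
    using A(1) axis_eq_0_iff[of i "1::'a"] by (auto simp: invertible_iff_kernel)
  ultimately show ?thesis by (rule that)
qed

text \<open>With the two null vectors as the first two basis vectors, the first two indeterminates
  drop out of the form.\<close>

lemma form_rank_le_2:
  assumes "null_vector M z1" "null_vector M z2"
    and ind: "\<And>a b. a *s z1 + b *s z2 = 0 \<Longrightarrow> a = 0 \<and> b = 0"
  shows "form_rank M \<le> 2"
proof -
  obtain w1 w2 where inv: "invertible (cols4 z1 z2 w1 w2)"
    using extend_pair_invertible[OF ind] by blast
  let ?N = "change_coords (cols4 z1 z2 w1 w2) M"
  have "?N $ i $ j = 0 \<and> ?N $ j $ i = 0" if "i = 1 \<or> i = 2" for i j
    using that assms(1,2)
    by (auto simp: change_coords_nth column_cols4 null_vector_def polar_commute[of M _ z1]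
        polar_commute[of M _ z2])
  then have "1 \<notin> indets ?N" "2 \<notin> indets ?N" by (auto simp: indets_def)
  then have "i \<in> {3, 4}" if "i \<in> indets ?N" for i using exhaust_4[of i] that by auto
  then have "indets ?N \<subseteq> {3, 4}" by blast
  then have "card (indets ?N) \<le> card {3, 4 :: 4}" by (rule card_mono[rotated]) simp
  also have "\<dots> \<le> 2" by (simp add: card_insert_if)
  finally have "card (indets ?N) \<le> 2" .
  moreover have "form_rank M \<le> card (indets ?N)"
    unfolding form_rank_def using inv by (intro Least_le) blast
  ultimately show ?thesis by simp
qed

section \<open>Normal form in rank 3\<close>

text \<open>On a complement of the line of \<open>z\<close> the form is a ternary quadratic, to
  which Chevalley--Warning applies; a nonzero vector of the complement is independent of
  \<open>z\<close>.\<close>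

lemma exists_isotropic_independent:
  fixes M :: "'a::{field, finite} ^ 4 ^ 4"
  assumes "z \<noteq> 0"
  obtains v where "form_eval M v = 0" "\<And>a b. a *s z + b *s v = 0 \<Longrightarrow> a = 0 \<and> b = 0"
proof -
  obtain u1 where u1: "u1 \<notin> vec.span {z}" using exists_notin_span[of "{z}"] by auto
  have ind: "a = 0 \<and> b = 0" if "a *s z + b *s u1 = 0" for a b
  proof -
    have "b = 0"
      by (rule notin_span_coeff_zero[OF u1 _ that]) (intro vec.span_scale vec.span_base; simp)
    with that assms show ?thesis by simp
  qed
  obtain u2 u3 where inv: "invertible (cols4 z u1 u2 u3)"
    using extend_pair_invertible[OF ind] by blast
  obtain x y w where nz: "(x, y, w) \<noteq> (0, 0, 0)" and
    iso: "form_eval M u1 * x\<^sup>2 + form_eval M u2 * y\<^sup>2 + form_eval M u3 * w\<^sup>2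
      + polar M u1 u2 * x * y + polar M u1 u3 * x * w + polar M u2 u3 * y * w = 0"
    by (rule ternary_quadratic_isotropic)
  show ?thesis
  proof
    show "form_eval M (x *s u1 + y *s u2 + w *s u3) = 0"
      using iso by (simp add: form_eval_add form_eval_scale polar_commute[of M u3] algebra_simps)
    fix a b
    let ?t = "vec4 a (b * x) (b * y) (b * w)"
    assume "a *s z + b *s (x *s u1 + y *s u2 + w *s u3) = 0"
    then have "cols4 z u1 u2 u3 *v ?t = 0"
      by (simp add: cols4_mult vec.scale_right_distrib add.assoc)
    with inv have "?t = 0"
      unfolding invertible_iff_kernel by blast
    then have "a = 0" "b * x = 0" "b * y = 0" "b * w = 0"
      unfolding vec_eq_iff forall_4 by simp_all
    with nz show "a = 0 \<and> b = 0" by auto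
  qed
qed

text \<open>In a basis of a hyperbolic pair \<open>v\<close>, \<open>u\<close>, a vector
  \<open>w\<close> orthogonal to both, and the vertex \<open>z\<close>, the only coefficient still
  to be controlled is the value at \<open>w\<close>.\<close>

lemma rank_3_normal_form:
  fixes M :: "'a::{field, finite} ^ 4 ^ 4"
  assumes "form_rank M = 3"
  obtains P :: "'a ^ 4 ^ 4" and e where "invertible P" "e \<noteq> 0"
    "\<And>x. form_eval M (P *v x) = e * (x $ 1 * x $ 3 - (x $ 2)\<^sup>2)"
proof -
  obtain z where z: "null_vector M z" "z \<noteq> 0"
    using null_vector_exists[of M] assms by auto
  then have z0: "form_eval M z = 0" "polar M z y = 0" "polar M y z = 0" for y
    by (auto simp: null_vector_def polar_commute[of M y])
  obtain v where v: "form_eval M v = 0"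
    and zv: "\<And>a b. a *s z + b *s v = 0 \<Longrightarrow> a = 0 \<and> b = 0"
    using exists_isotropic_independent[OF z(2)] by blast
  \<comment> \<open>A second independent null vector would lower the rank to 2, so \<open>v\<close>
    pairs nontrivially with some vector.\<close>
  have "\<not> null_vector M v"
    using form_rank_le_2[OF z(1) _ zv] assms by auto
  with v obtain u0 where u0: "polar M v u0 \<noteq> 0" by (auto simp: null_vector_def)
  define u1 where "u1 = inverse (polar M v u0) *s u0"
  have u1: "polar M v u1 = 1" using u0 by (simp add: u1_def)
  then have u1': "polar M u1 v = 1" by (simp add: polar_commute)
  \<comment> \<open>As \<open>v\<close> is isotropic and \<open>polar M u1 v = 1\<close>,
    subtracting \<open>form_eval M u1\<close> times \<open>v\<close> makes the value at
    \<open>u\<close> zero and keeps the pairing with \<open>v\<close>.\<close>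
  define u where "u = u1 + (- form_eval M u1) *s v"
  have vv: "polar M v v = 0" by (simp add: polar_self v)
  have vu: "polar M v u = 1" "polar M u v = 1"
    using u1 u1' by (simp_all add: u_def vv)
  have u: "form_eval M u = 0"
    using u1' v by (simp add: u_def form_eval_diff form_eval_scale)
  have uu: "polar M u u = 0" by (simp add: polar_self u)
  have "card {z, v, u} < 4" by (simp add: card_insert_if)
  then obtain w0 where w0: "w0 \<notin> vec.span {z, v, u}"
    using exists_notin_span[of "{z, v, u}"] by auto
  \<comment> \<open>The projection of \<open>w0\<close> to the orthogonal complement of the
    hyperbolic plane of \<open>v\<close> and \<open>u\<close>.\<close>
  define w where "w = w0 + (- polar M w0 u) *s v + (- polar M w0 v) *s u"
  have wvu: "polar M w v = 0" "polar M w u = 0"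
    by (simp_all add: w_def vu vv uu)
  then have vuw: "polar M v w = 0" "polar M u w = 0"
    by (simp_all add: polar_commute[of M _ w])
  have ind: "\<alpha> = 0 \<and> \<beta> = 0 \<and> \<gamma> = 0 \<and> \<delta> = 0"
    if 0: "\<alpha> *s v + \<beta> *s w + \<gamma> *s u + \<delta> *s z = 0" for \<alpha> \<beta> \<gamma> \<delta>
  proof -
    \<comment> \<open>Pairing the relation with \<open>v\<close> and with \<open>u\<close> isolates
      \<open>\<gamma>\<close> and \<open>\<alpha>\<close>; then \<open>\<beta> = 0\<close> because
      \<open>w0\<close> lies outside the span of the other three vectors.\<close>
    have "polar M v (\<alpha> *s v + \<beta> *s w + \<gamma> *s u + \<delta> *s z) = \<gamma>"
      by (simp add: vv vu wvu vuw z0)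
    with 0 have \<gamma>: "\<gamma> = 0" by simp
    have "polar M u (\<alpha> *s v + \<beta> *s w + \<gamma> *s u + \<delta> *s z) = \<alpha>"
      by (simp add: uu vu wvu vuw z0)
    with 0 have \<alpha>: "\<alpha> = 0" by simp
    have eq: "(- (\<beta> * polar M w0 u)) *s v + (- (\<beta> * polar M w0 v)) *s u + \<delta> *s z + \<beta> *s w0 = 0"
      using 0 \<alpha> \<gamma> by (simp add: w_def vec_eq_iff algebra_simps)
    have "\<beta> = 0"
      by (rule notin_span_coeff_zero[OF w0 _ eq])
        (intro vec.span_add vec.span_scale vec.span_base; simp)
    with 0 \<alpha> \<gamma> z(2) show ?thesis by simp
  qed
  define e where "e = - form_eval M w"
  \<comment> \<open>If \<open>w\<close> were isotropic, it would be orthogonal to the whole basis,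
    hence a null vector independent of \<open>z\<close>, contradicting rank 3.\<close>
  have "e \<noteq> 0"
  proof
    assume "e = 0"
    then have w: "form_eval M w = 0" by (simp add: e_def)
    then have ww: "polar M w w = 0" by (simp add: polar_self)
    have "x = 0" if "cols4 v w u z *v x = 0" for x
    proof -
      from that have "x $ 1 *s v + x $ 2 *s w + x $ 3 *s u + x $ 4 *s z = 0"
        by (simp only: cols4_mult)
      from ind[OF this] show ?thesis by (simp add: vec_eq_iff forall_4)
    qed
    then have inv: "invertible (cols4 v w u z)" by (simp add: invertible_iff_kernel)
    have "polar M w y = 0" for y
    proof -
      obtain A' where "cols4 v w u z ** A' = mat 1" using inv by (auto simp: invertible_def)
      then have "y = cols4 v w u z *v (A' *v y)" by (simp add: matrix_vector_mul_assoc)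
      also have "polar M w \<dots> = 0" by (simp add: cols4_mult wvu vuw ww z0)
      finally show ?thesis .
    qed
    with w have "null_vector M w" by (simp add: null_vector_def)
    moreover have "a = 0 \<and> b = 0" if "a *s z + b *s w = 0" for a b
      using ind[of 0 b 0 a] that by (simp add: add.commute)
    ultimately have "form_rank M \<le> 2" by (intro form_rank_le_2[OF z(1)]) auto
    with assms show False by simp
  qed
  \<comment> \<open>Scaling \<open>v\<close> by \<open>e\<close> turns its pairing with
    \<open>u\<close> into \<open>e\<close>, which matches the value \<open>- e\<close> at
    \<open>w\<close>.\<close>
  show ?thesis
  proof (rule that[of "cols4 (e *s v) w u z" e])
    show "e \<noteq> 0" by fact
    show "invertible (cols4 (e *s v) w u z)"
      unfolding invertible_iff_kernel
    proof (intro allI impI)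
      fix x assume "cols4 (e *s v) w u z *v x = 0"
      then have "(x $ 1 * e) *s v + x $ 2 *s w + x $ 3 *s u + x $ 4 *s z = 0"
        by (simp add: cols4_mult)
      from ind[OF this] \<open>e \<noteq> 0\<close> show "x = 0" by (simp add: vec_eq_iff forall_4)
    qed
    show "form_eval M (cols4 (e *s v) w u z *v x) = e * (x $ 1 * x $ 3 - (x $ 2)\<^sup>2)" for x
      by (simp add: cols4_mult form_eval_add form_eval_diff form_eval_scale v u z0 wvu vuw vu e_def
          algebra_simps)
  qed
qed

section \<open>From projective points to vectors\<close>

text \<open>Each vector of \<open>S\<close> is \<open>c *s t\<close> for exactly one pair. Two
  different systems of representatives can thus be compared through the vectors they
  generate.\<close>

lemma card_scaling_transversal:
  fixes S T :: "('a::{field, finite} ^ 'n) set"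
  assumes closed: "\<And>c x. c \<noteq> 0 \<Longrightarrow> x \<in> T \<Longrightarrow> c *s x \<in> S"
    and rep: "\<And>x. x \<in> S \<Longrightarrow> \<exists>c t. c \<noteq> 0 \<and> t \<in> T \<and> x = c *s t"
    and uniq: "\<And>c t. t \<in> T \<Longrightarrow> c *s t \<in> T \<Longrightarrow> c \<noteq> 0 \<Longrightarrow> c = 1"
  shows "card S = (CARD('a) - 1) * card T"
proof -
  have inj: "c = d \<and> s = t"
    if "c \<noteq> 0" "d \<noteq> 0" "s \<in> T" "t \<in> T" and eq: "c *s s = d *s t" for c d s t
  proof -
    have "inverse d *s (d *s t) = t" "inverse d *s (c *s s) = (c / d) *s s"
      using \<open>d \<noteq> 0\<close> by (simp_all add: field_simps)
    then have t: "t = (c / d) *s s" using eq by simp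
    with that uniq[of s "c / d"] have "c / d = 1" by auto
    with t \<open>d \<noteq> 0\<close> show ?thesis by simp
  qed
  have "bij_betw (\<lambda>(c, t). c *s t) ((UNIV - {0}) \<times> T) S"
    unfolding bij_betw_def
  proof
    show "inj_on (\<lambda>(c, t). c *s t) ((UNIV - {0}) \<times> T)"
      by (rule inj_onI) (use inj in auto)
    show "(\<lambda>(c, t). c *s t) ` ((UNIV - {0}) \<times> T) = S"
      using closed rep by (force simp: image_iff)
  qed
  then have "card S = card ((UNIV - {0::'a}) \<times> T)" by (simp add: bij_betw_same_card)
  then show ?thesis by (simp add: card_cartesian_product card_Diff_singleton)
qed

lemma proj_points_normalize:
  fixes x :: "'a::field ^ 4"
  assumes "x \<noteq> 0"
  obtains c t where "c \<noteq> 0" "t \<in> proj_points" "x = c *s t"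
proof -
  define i where "i = Min {i. x $ i \<noteq> 0}"
  have "{i. x $ i \<noteq> 0} \<noteq> {}" using assms by (auto simp: vec_eq_iff)
  then have i: "x $ i \<noteq> 0" using Min_in[of "{i. x $ i \<noteq> 0}"] by (simp add: i_def)
  have "x $ j = 0" if "j < i" for j
    using Min_le[of "{i. x $ i \<noteq> 0}" j] that unfolding i_def[symmetric]
    by (metis finite leD mem_Collect_eq)
  with i have "inverse (x $ i) *s x \<in> proj_points"
    unfolding proj_points_def by (auto intro!: exI[of _ i])
  with i show ?thesis by (intro that[of "x $ i" "inverse (x $ i) *s x"]) simp_all
qed

lemma proj_points_scale_unique:
  assumes "t \<in> proj_points" "c *s t \<in> proj_points"
  shows "c = 1"
proof -
  obtain i where i: "t $ i = 1" "\<And>j. j < i \<Longrightarrow> t $ j = 0"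
    using assms(1) by (auto simp: proj_points_def)
  obtain k where k: "c * t $ k = 1" "\<And>j. j < k \<Longrightarrow> c * t $ j = 0"
    using assms(2) by (auto simp: proj_points_def)
  have "\<not> k < i" using i(2) k(1) by force
  moreover have "\<not> i < k" using i(1) k by force
  ultimately have "i = k" by simp
  with i k show ?thesis by simp
qed

text \<open>The weight of the codeword of \<open>G\<close> on the cone \<open>x\<^sub>1 x\<^sub>3 = x\<^sub>2\<^sup>2\<close>: the points other than the
vertex \<open>(0, 0, 0, 1)\<close> lie on the lines through it over the conic points \<open>(1, t, t\<^sup>2)\<close> and
\<open>(0, 0, 1)\<close>.\<close>

definition cone_weight :: "'a::{field, finite} ^ 4 ^ 4 \<Rightarrow> nat" where
  "cone_weight G = (\<Sum>t\<in>UNIV. card {w. form_eval G (vec4 1 t (t\<^sup>2) w) \<noteq> 0})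
     + card {w. form_eval G (vec4 0 0 1 w) \<noteq> 0}
     + (if form_eval G (vec4 0 0 0 1) \<noteq> 0 then 1 else 0)"

lemma card_standard_cone_nonzeros:
  fixes G :: "'a::{field, finite} ^ 4 ^ 4"
  shows "card {x. x $ 1 * x $ 3 = (x $ 2)\<^sup>2 \<and> form_eval G x \<noteq> 0} = (CARD('a) - 1) * cone_weight G"
proof -
  define T1 where "T1 = (\<lambda>(t, w). vec4 1 t (t\<^sup>2) w) ` (SIGMA t:UNIV. {w. form_eval G (vec4 1 t (t\<^sup>2) w) \<noteq> 0})"
  define T2 where "T2 = vec4 0 0 1 ` {w. form_eval G (vec4 0 0 1 w) \<noteq> 0}"
  define T3 where "T3 = {x. x = vec4 0 0 0 1 \<and> form_eval G x \<noteq> 0}"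
  have eqD: "a = a' \<and> b = b' \<and> c = c' \<and> d = d'" if "vec4 a b c d = vec4 a' b' c' d'"
    for a b c d a' b' c' d' :: 'a
    using that by (metis vec4_nth)
  have c1: "card T1 = (\<Sum>t\<in>UNIV. card {w. form_eval G (vec4 1 t (t\<^sup>2) w) \<noteq> 0})"
    unfolding T1_def by (subst card_image) (auto intro!: inj_onI dest!: eqD)
  have c2: "card T2 = card {w. form_eval G (vec4 0 0 1 w) \<noteq> 0}"
    unfolding T2_def by (subst card_image) (auto intro!: inj_onI dest!: eqD)
  have c3: "card T3 = (if form_eval G (vec4 0 0 0 1) \<noteq> 0 then 1 else 0)"
  proof -
    have "T3 = (if form_eval G (vec4 0 0 0 1) \<noteq> 0 then {vec4 0 0 0 1} else {})"
      by (auto simp: T3_def)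
    then show ?thesis by simp
  qed
  have "T1 \<inter> T2 = {}" "(T1 \<union> T2) \<inter> T3 = {}"
    by (auto simp: T1_def T2_def T3_def dest!: eqD)
  then have card_T: "card (T1 \<union> T2 \<union> T3) = cone_weight G"
    by (simp add: card_Un_disjoint c1 c2 c3 cone_weight_def)
  \<comment> \<open>One representative per point: the first nonzero entry among coordinates
    \<open>1\<close>, \<open>3\<close>, \<open>4\<close> is normalized to \<open>1\<close>.\<close>
  have T: "x \<in> T1 \<union> T2 \<union> T3 \<longleftrightarrow> x $ 1 * x $ 3 = (x $ 2)\<^sup>2 \<and> form_eval G x \<noteq> 0 \<and>
      (x $ 1 = 1 \<or> x $ 1 = 0 \<and> x $ 3 = 1 \<or> x $ 1 = 0 \<and> x $ 3 = 0 \<and> x $ 4 = 1)" for x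
  proof
    assume "x \<in> T1 \<union> T2 \<union> T3"
    then show "x $ 1 * x $ 3 = (x $ 2)\<^sup>2 \<and> form_eval G x \<noteq> 0 \<and>
      (x $ 1 = 1 \<or> x $ 1 = 0 \<and> x $ 3 = 1 \<or> x $ 1 = 0 \<and> x $ 3 = 0 \<and> x $ 4 = 1)"
      by (auto simp: T1_def T2_def T3_def)
  next
    assume *: "x $ 1 * x $ 3 = (x $ 2)\<^sup>2 \<and> form_eval G x \<noteq> 0 \<and>
      (x $ 1 = 1 \<or> x $ 1 = 0 \<and> x $ 3 = 1 \<or> x $ 1 = 0 \<and> x $ 3 = 0 \<and> x $ 4 = 1)"
    have x: "x = vec4 (x $ 1) (x $ 2) (x $ 3) (x $ 4)" by (simp add: vec_eq_iff forall_4)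
    from * consider "x $ 1 = 1" | "x $ 1 = 0" "x $ 3 = 1" | "x $ 1 = 0" "x $ 3 = 0" "x $ 4 = 1"
      by blast
    then show "x \<in> T1 \<union> T2 \<union> T3"
    proof cases
      case 1
      with * x have "x = vec4 1 (x $ 2) ((x $ 2)\<^sup>2) (x $ 4)" by simp
      with * have "x \<in> T1" unfolding T1_def by (intro image_eqI[of _ _ "(x $ 2, x $ 4)"]) auto
      then show ?thesis by simp
    next
      case 2
      with * x have "x = vec4 0 0 1 (x $ 4)" by simp
      with * have "x \<in> T2" unfolding T2_def by (intro image_eqI[of _ _ "x $ 4"]) auto
      then show ?thesis by simp
    next
      case 3
      with * x have "x = vec4 0 0 0 1" by simp
      with * show ?thesis by (simp add: T3_def)
    qed
  qed
  have "card {x. x $ 1 * x $ 3 = (x $ 2)\<^sup>2 \<and> form_eval G x \<noteq> 0}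
      = (CARD('a) - 1) * card (T1 \<union> T2 \<union> T3)"
  proof (rule card_scaling_transversal)
    fix c :: 'a and x assume "c \<noteq> 0" "x \<in> T1 \<union> T2 \<union> T3"
    then show "c *s x \<in> {x. x $ 1 * x $ 3 = (x $ 2)\<^sup>2 \<and> form_eval G x \<noteq> 0}"
      unfolding T by (auto simp: form_eval_scale power2_eq_square mult_ac)
  next
    fix x assume "x \<in> {x. x $ 1 * x $ 3 = (x $ 2)\<^sup>2 \<and> form_eval G x \<noteq> 0}"
    then have x: "x $ 1 * x $ 3 = (x $ 2)\<^sup>2" "form_eval G x \<noteq> 0" by auto
    have *: "\<exists>c t. c \<noteq> 0 \<and> t \<in> T1 \<union> T2 \<union> T3 \<and> x = c *s t"
      if "d \<noteq> 0" "inverse d *s x \<in> T1 \<union> T2 \<union> T3" for d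
      using that by (intro exI[of _ d] exI[of _ "inverse d *s x"]) simp
    have mem: "inverse d *s x \<in> T1 \<union> T2 \<union> T3 \<longleftrightarrow>
       x $ 1 = d \<or> x $ 1 = 0 \<and> x $ 3 = d \<or> x $ 1 = 0 \<and> x $ 3 = 0 \<and> x $ 4 = d"
      if "d \<noteq> 0" for d
      unfolding T using x that
      by (auto simp: form_eval_scale power2_eq_square field_simps)
    have "x \<noteq> 0"
      using x by (auto simp: form_eval_bil)
    have "x $ 1 \<noteq> 0 \<or> x $ 3 \<noteq> 0 \<or> x $ 4 \<noteq> 0"
    proof (rule ccontr)
      assume 0: "\<not> (x $ 1 \<noteq> 0 \<or> x $ 3 \<noteq> 0 \<or> x $ 4 \<noteq> 0)"
      with x(1) have "x $ 2 = 0" by simp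
      with 0 \<open>x \<noteq> 0\<close> show False by (simp add: vec_eq_iff forall_4)
    qed
    then consider "x $ 1 \<noteq> 0" | "x $ 1 = 0" "x $ 3 \<noteq> 0" | "x $ 1 = 0" "x $ 3 = 0" "x $ 4 \<noteq> 0"
      by blast
    then show "\<exists>c t. c \<noteq> 0 \<and> t \<in> T1 \<union> T2 \<union> T3 \<and> x = c *s t"
    proof cases
      case 1
      show ?thesis by (rule *[OF 1]) (simp add: mem[OF 1] del: Un_iff)
    next
      case 2
      show ?thesis by (rule *[OF 2(2)]) (simp add: mem[OF 2(2)] 2(1) del: Un_iff)
    next
      case 3
      show ?thesis by (rule *[OF 3(3)]) (simp add: mem[OF 3(3)] 3(1,2) del: Un_iff)
    qed
  next
    fix c :: 'a and t assume "t \<in> T1 \<union> T2 \<union> T3" "c *s t \<in> T1 \<union> T2 \<union> T3" "c \<noteq> 0"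
    then show "c = 1" unfolding T by auto
  qed
  then show ?thesis by (simp add: card_T)
qed

lemma cone_weight_cong:
  assumes "\<And>x. form_eval G x = form_eval H x"
  shows "cone_weight G = cone_weight H"
  by (simp add: cone_weight_def assms)

text \<open>\<open>P\<close> need not map normalized representatives to normalized ones, but it is a
  bijection between the sets of vectors. Both sides times \<open>q - 1\<close> count those
  vectors.\<close>

lemma weight_zero_set_cone_weight:
  fixes M :: "'a::{field, finite} ^ 4 ^ 4"
  assumes P: "invertible P" and "e \<noteq> 0"
    and nf: "\<And>x. form_eval M (P *v x) = e * (x $ 1 * x $ 3 - (x $ 2)\<^sup>2)"
  shows "weight (zero_set M) (restrict (form_eval g) (zero_set M)) = cone_weight (change_coords P g)"
proof -
  let ?T = "{x \<in> proj_points. form_eval M x = 0 \<and> form_eval g x \<noteq> 0}"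
  let ?S = "{x. form_eval M x = 0 \<and> form_eval g x \<noteq> 0}"
  let ?C = "{x. x $ 1 * x $ 3 = (x $ 2)\<^sup>2 \<and> form_eval (change_coords P g) x \<noteq> 0}"
  have pos: "0 < CARD('a) - 1"
    using card_mono[of UNIV "{0, 1::'a}"] by simp
  have "weight (zero_set M) (restrict (form_eval g) (zero_set M)) = card ?T"
    unfolding weight_def zero_set_def by (rule arg_cong[of _ _ card]) auto
  moreover have "card ?S = (CARD('a) - 1) * card ?T"
  proof (rule card_scaling_transversal)
    fix c :: 'a and x assume "c \<noteq> 0" "x \<in> ?T"
    then show "c *s x \<in> ?S" by (auto simp: form_eval_scale)
  next
    fix x assume x: "x \<in> ?S"
    then have "x \<noteq> 0" by (auto simp: form_eval_bil)
    then obtain c t where "c \<noteq> 0" "t \<in> proj_points" "x = c *s t"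
      by (rule proj_points_normalize)
    with x show "\<exists>c t. c \<noteq> 0 \<and> t \<in> ?T \<and> x = c *s t"
      by (intro exI[of _ c] exI[of _ t]) (auto simp: form_eval_scale)
  next
    fix c :: 'a and t assume "t \<in> ?T" "c *s t \<in> ?T"
    then show "c = 1" by (auto intro: proj_points_scale_unique)
  qed
  moreover have "card ?S = card ?C"
  proof -
    obtain P' where P': "P ** P' = mat 1" "P' ** P = mat 1" using P by (auto simp: invertible_def)
    have iff: "form_eval M (P *v x) = 0 \<longleftrightarrow> x $ 1 * x $ 3 = (x $ 2)\<^sup>2" for x
      by (simp add: nf \<open>e \<noteq> 0\<close>)
    have inv: "P *v (P' *v x) = x" "P' *v (P *v x) = x" for x
      by (simp_all add: matrix_vector_mul_assoc P')
    have "bij_betw ((*v) P) ?C ?S"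
      by (rule bij_betwI[where g = "(*v) P'"])
        (auto simp: form_eval_change_coords inv simp flip: iff)
    then show ?thesis by (simp add: bij_betw_same_card)
  qed
  ultimately show ?thesis using pos by (simp add: card_standard_cone_nonzeros)
qed

text \<open>The normal form reduces every cone to the standard one, so the set of weights depends on
  the field only.\<close>

lemma weights_functional_code:
  fixes X :: "('a::{field, finite} ^ 4) set"
  assumes "quadric_cone X"
  shows "weight X ` functional_code X = range (cone_weight :: 'a ^ 4 ^ 4 \<Rightarrow> nat)"
proof -
  obtain M where M: "form_rank M = 3" "X = zero_set M"
    using assms by (auto simp: quadric_cone_def)
  obtain P :: "'a ^ 4 ^ 4" and e where P: "invertible P" "e \<noteq> 0"
    "\<And>x. form_eval M (P *v x) = e * (x $ 1 * x $ 3 - (x $ 2)\<^sup>2)"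
    using rank_3_normal_form[OF M(1)] by blast
  have w: "weight X (restrict (form_eval g) X) = cone_weight (change_coords P g)" for g
    unfolding M(2) by (rule weight_zero_set_cone_weight[OF P])
  show ?thesis
  proof
    show "weight X ` functional_code X \<subseteq> range (cone_weight :: 'a ^ 4 ^ 4 \<Rightarrow> nat)"
      unfolding functional_code_def image_image w by (rule image_subsetI) (rule rangeI)
    show "range (cone_weight :: 'a ^ 4 ^ 4 \<Rightarrow> nat) \<subseteq> weight X ` functional_code X"
    proof
      fix n assume "n \<in> range (cone_weight :: 'a ^ 4 ^ 4 \<Rightarrow> nat)"
      then obtain G :: "'a ^ 4 ^ 4" where n: "n = cone_weight G" by blast
      obtain P' where P': "P' ** P = mat 1" using P(1) by (auto simp: invertible_def)
      \<comment> \<open>\<open>G\<close> may fail to be upper triangular;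
        \<open>change_coords P' G\<close> is upper triangular, and pulling it back along
        \<open>P\<close> gives the same function as \<open>G\<close>.\<close>
      have "n = cone_weight (change_coords P (change_coords P' G))"
        unfolding n by (rule cone_weight_cong)
          (simp add: form_eval_change_coords matrix_vector_mul_assoc P')
      then have "n = weight X (restrict (form_eval (change_coords P' G)) X)" by (simp add: w)
      then show "n \<in> weight X ` functional_code X"
        unfolding functional_code_def by (blast intro: change_coords_quadratic_forms)
    qed
  qed
qed

section \<open>Counting along the lines of the cone\<close>

lemma card_nonzeros:
  fixes f :: "'b::finite \<Rightarrow> 'a::zero"
  shows "card {x. f x \<noteq> 0} = CARD('b) - card {x. f x = 0}"
proof -
  have "{x. f x \<noteq> 0} = UNIV - {x. f x = 0}" by auto
  then show ?thesis by (simp add: card_Diff_subset)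
qed

lemma card_poly_zeros_le:
  fixes p :: "'a::{field, finite} poly"
  assumes "p \<noteq> 0" "degree p \<le> n"
  shows "card {x. poly p x = 0} \<le> n"
  using card_poly_roots_bound[OF assms(1)] assms(2) by simp

lemma card_quadratic_nonzeros_ge:
  fixes a b c :: "'a::{field, finite}"
  assumes "a \<noteq> 0"
  shows "CARD('a) - 2 \<le> card {w. a * w\<^sup>2 + b * w + c \<noteq> 0}"
proof -
  have "a * w\<^sup>2 + b * w + c = poly [:c, b, a:] w" for w
    by (simp add: power2_eq_square algebra_simps)
  moreover have "card {w. poly [:c, b, a:] w = 0} \<le> 2"
    using assms by (intro card_poly_zeros_le) auto
  ultimately show ?thesis by (simp only: card_nonzeros diff_le_mono2)
qed

lemma card_linear_nonzeros:
  fixes a b :: "'a::{field, finite}"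
  assumes "a \<noteq> 0"
  shows "card {w. a * w + b \<noteq> 0} = CARD('a) - 1"
proof -
  have "a * w + b = 0 \<longleftrightarrow> w = - b / a" for w
    using assms by (auto simp: field_simps eq_neg_iff_add_eq_0)
  then have "{w. a * w + b = 0} = {- b / a}" by auto
  then show ?thesis unfolding card_nonzeros by simp
qed

text \<open>\<open>l2\<close> and \<open>m4\<close> are the values at infinity of the polynomials in
  \<open>t\<close>, read as binary forms of degrees 2 and 4. A zero at infinity is thus a drop in
  degree.\<close>

lemma form_eval_cone_points:
  fixes G :: "'a::field ^ 4 ^ 4"
  obtains c l0 l1 l2 m0 m1 m2 m3 m4 where
    "\<And>t w. form_eval G (vec4 1 t (t\<^sup>2) w) =
       c * w\<^sup>2 + poly [:l0, l1, l2:] t * w + poly [:m0, m1, m2, m3, m4:] t"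
    "\<And>w. form_eval G (vec4 0 0 1 w) = c * w\<^sup>2 + l2 * w + m4"
    "form_eval G (vec4 0 0 0 1) = c"
proof
  show "form_eval G (vec4 1 t (t\<^sup>2) w) = G $ 4 $ 4 * w\<^sup>2
      + poly [:G $ 1 $ 4 + G $ 4 $ 1, G $ 2 $ 4 + G $ 4 $ 2, G $ 3 $ 4 + G $ 4 $ 3:] t * w
      + poly [:G $ 1 $ 1, G $ 1 $ 2 + G $ 2 $ 1, G $ 1 $ 3 + G $ 2 $ 2 + G $ 3 $ 1,
          G $ 2 $ 3 + G $ 3 $ 2, G $ 3 $ 3:] t" for t w
    by (simp add: form_eval_def sum_4 power2_eq_square algebra_simps)
qed (simp_all add: form_eval_def sum_4 power2_eq_square algebra_simps)

lemma sum_card_const: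
  fixes Z :: "'a::finite set"
  shows "(\<Sum>t\<in>UNIV. card {w::'a. t \<notin> Z}) = CARD('a) * (CARD('a) - card Z)"
proof -
  have "(\<Sum>t\<in>UNIV. card {w::'a. t \<notin> Z}) = (\<Sum>t\<in>UNIV. if t \<in> Z then 0 else CARD('a))"
    by (intro sum.cong refl) simp
  also have "\<dots> = CARD('a) * card (UNIV - Z)" by (simp add: sum.If_cases Compl_eq_Diff_UNIV)
  finally show ?thesis by (simp add: card_Diff_subset)
qed

lemma cone_weight_cases:
  fixes G :: "'a::{field, finite} ^ 4 ^ 4" and q :: nat
  assumes q: "CARD('a) = q" "q \<ge> 3"
  shows "cone_weight G = 0 \<or> cone_weight G = q * (q - 3) \<or> cone_weight G = q * (q - 2)
    \<or> (q - 1)\<^sup>2 \<le> cone_weight G"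
proof -
  obtain c l0 l1 l2 m0 m1 m2 m3 m4 where G:
    "\<And>t w. form_eval G (vec4 1 t (t\<^sup>2) w) =
       c * w\<^sup>2 + poly [:l0, l1, l2:] t * w + poly [:m0, m1, m2, m3, m4:] t"
    "\<And>w. form_eval G (vec4 0 0 1 w) = c * w\<^sup>2 + l2 * w + m4"
    "form_eval G (vec4 0 0 0 1) = c"
    using form_eval_cone_points[of G] by blast
  define L where "L = [:l0, l1, l2:]"
  define Q where "Q = [:m0, m1, m2, m3, m4:]"
  have W: "cone_weight G = (\<Sum>t\<in>UNIV. card {w. c * w\<^sup>2 + poly L t * w + poly Q t \<noteq> 0})
     + card {w. c * w\<^sup>2 + l2 * w + m4 \<noteq> 0} + (if c \<noteq> 0 then 1 else 0)"
    by (simp only: cone_weight_def G L_def Q_def)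
  obtain r where r: "q = r + 3" using q(2) by (metis le_add_diff_inverse2)
  show ?thesis
  proof (cases "c = 0")
    case False
    \<comment> \<open>Each of the \<open>q + 1\<close> lines has at most two zeros off the vertex,
      and the vertex itself contributes \<open>1\<close>.\<close>
    have ge: "q - 2 \<le> card {w. c * w\<^sup>2 + b * w + d \<noteq> 0}" for b d
      using card_quadratic_nonzeros_ge[OF False] q(1) by blast
    have "(q - 2) * q = (\<Sum>t\<in>(UNIV :: 'a set). q - 2)" using q(1) by simp
    also have "\<dots> \<le> (\<Sum>t\<in>UNIV. card {w. c * w\<^sup>2 + poly L t * w + poly Q t \<noteq> 0})"
      by (intro sum_mono ge)
    finally have "(q - 2) * q + (q - 2) \<le> \<dots> + card {w. c * w\<^sup>2 + l2 * w + m4 \<noteq> 0}"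
      using ge by (intro add_mono)
    moreover have "(q - 1)\<^sup>2 \<le> (q - 2) * q + (q - 2) + 1"
      by (simp add: r power2_eq_square algebra_simps)
    ultimately show ?thesis using False by (auto simp: W)
  next
    case c: True
    show ?thesis
    proof (cases "L = 0")
      case False
      define Z where "Z = {t. poly L t = 0}"
      \<comment> \<open>Off the zeros of \<open>L\<close> the form is linear in \<open>w\<close> and
        has exactly one zero on the line.\<close>
      have "(q - card Z) * (q - 1) = (\<Sum>t\<in>UNIV - Z. q - 1)"
        using q(1) by (simp add: card_Diff_subset)
      also have "\<dots> = (\<Sum>t\<in>UNIV - Z. card {w. poly L t * w + poly Q t \<noteq> 0})"
        using q(1) by (intro sum.cong refl) (simp add: Z_def card_linear_nonzeros)
      also have "\<dots> \<le> (\<Sum>t\<in>UNIV. card {w. poly L t * w + poly Q t \<noteq> 0})"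
        by (intro sum_mono2) auto
      finally have ge: "(q - card Z) * (q - 1) + card {w. l2 * w + m4 \<noteq> 0} \<le> cone_weight G"
        by (simp add: W c)
      have "(q - 1)\<^sup>2 \<le> (q - card Z) * (q - 1) + card {w. l2 * w + m4 \<noteq> 0}"
      \<comment> \<open>If \<open>L\<close> vanishes at infinity it has at most one finite zero;
        otherwise the line at infinity adds \<open>q - 1\<close>. Either way at least
        \<open>q - 1\<close> lines contribute \<open>q - 1\<close> each.\<close>
      proof (cases "l2 = 0")
        case True
        have "card Z \<le> 1"
          unfolding Z_def using False True by (intro card_poly_zeros_le) (auto simp: L_def)
        then have "(q - 1) * (q - 1) \<le> (q - card Z) * (q - 1)" by (intro mult_right_mono) auto
        then show ?thesis unfolding power2_eq_square by (rule trans_le_add1)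
      next
        case l2: False
        have "card Z \<le> 2"
          unfolding Z_def using False by (intro card_poly_zeros_le) (auto simp: L_def)
        then have "(q - 2) * (q - 1) \<le> (q - card Z) * (q - 1)" by (intro mult_right_mono) auto
        then have "(q - 2) * (q - 1) + (q - 1) \<le> (q - card Z) * (q - 1) + card {w. l2 * w + m4 \<noteq> 0}"
          using card_linear_nonzeros[OF l2] q(1) by simp
        moreover have "(q - 2) * (q - 1) + (q - 1) = (q - 1)\<^sup>2"
          by (simp add: r power2_eq_square algebra_simps)
        ultimately show ?thesis by simp
      qed
      with ge show ?thesis by linarith
    next
      case L: True
      define Z where "Z = {t. poly Q t = 0}"
      have "(\<Sum>t\<in>UNIV. card {w::'a. poly Q t \<noteq> 0}) = q * (q - card Z)"
        using sum_card_const[of Z] q(1) by (simp add: Z_def)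
      then have wt: "cone_weight G = q * (q - card Z) + (if m4 = 0 then 0 else q)"
        using L q(1) by (simp add: W c L_def)
      show ?thesis
      proof (cases "Q = 0")
        case True
        then show ?thesis using wt q(1) by (simp add: Z_def Q_def)
      next
        case False
        \<comment> \<open>The number of zeros of the binary quartic, infinity included; a zero there
          leaves degree at most 3 for the finite ones.\<close>
        define k where "k = card Z + (if m4 = 0 then 1 else 0)"
        have "card Z \<le> (if m4 = 0 then 3 else 4)"
          unfolding Z_def using False by (intro card_poly_zeros_le) (auto simp: Q_def)
        \<comment> \<open>Keeps the subtraction from truncating for \<open>q = 3\<close>, where the
          degree bound 4 exceeds the size of the field.\<close>
        moreover have "card Z \<le> q" using q(1) card_mono[of UNIV Z] by simp
        ultimately have "k \<le> 4" and wt: "cone_weight G = q * (q + 1 - k)"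
          unfolding wt k_def by (auto simp: algebra_simps Suc_diff_le split: if_splits)
        have "(q - 1)\<^sup>2 \<le> cone_weight G" if "k \<le> 2"
        proof -
          have "(q - 1) * (q - 1) \<le> q * (q + 1 - k)" using that by (intro mult_mono) auto
          then show ?thesis by (simp add: wt power2_eq_square)
        qed
        moreover have "k \<le> 2 \<or> k = 3 \<or> k = 4" using \<open>k \<le> 4\<close> by linarith
        ultimately show ?thesis using wt by auto
      qed
    qed
  qed
qed

section \<open>Forms attaining the weights\<close>

text \<open>These forms are products of \<open>x $ 2\<close> and a linear form. The factor
  \<open>x $ 2\<close> vanishes at the vertex and on the line at infinity, so only the lines with
  parameter \<open>t\<close> contribute.\<close>

lemma cone_weight_example:
  fixes \<alpha> \<beta> \<gamma> \<delta> :: "'a::{field, finite}"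
  obtains G :: "'a ^ 4 ^ 4" where
    "cone_weight G = (\<Sum>t\<in>UNIV. card {w. t * (\<alpha> + \<beta> * t + \<gamma> * t\<^sup>2 + \<delta> * w) \<noteq> 0})"
proof -
  define G :: "'a ^ 4 ^ 4" where
    "G = cols4 0 (vec4 \<alpha> \<beta> 0 0) (vec4 0 \<gamma> 0 0) (vec4 0 \<delta> 0 0)"
  have "form_eval G (vec4 a b c d) = \<alpha> * a * b + \<beta> * b\<^sup>2 + \<gamma> * b * c + \<delta> * b * d" for a b c d
    by (simp add: G_def cols4_def form_eval_def sum_4 power2_eq_square algebra_simps)
  then have "cone_weight G = (\<Sum>t\<in>UNIV. card {w. t * (\<alpha> + \<beta> * t + \<gamma> * t\<^sup>2 + \<delta> * w) \<noteq> 0})"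
    unfolding cone_weight_def by (simp add: power2_eq_square algebra_simps)
  then show ?thesis by (rule that)
qed

lemma cone_weights_attained:
  fixes q :: nat
  assumes q: "CARD('a::{field, finite}) = q" "q \<ge> 3"
  shows "q * (q - 3) \<in> range (cone_weight :: 'a ^ 4 ^ 4 \<Rightarrow> nat)" (is ?A)
    and "q * (q - 2) \<in> range (cone_weight :: 'a ^ 4 ^ 4 \<Rightarrow> nat)" (is ?B)
    and "(q - 1)\<^sup>2 \<in> range (cone_weight :: 'a ^ 4 ^ 4 \<Rightarrow> nat)" (is ?C)
proof -
  have "card {0, 1 :: 'a} < CARD('a)" using q by simp
  then obtain a :: 'a where a: "a \<notin> {0, 1}" by (metis UNIV_eq_I less_irrefl)
  \<comment> \<open>The quartic becomes \<open>t * (t - 1) * (t - a)\<close>, with four distinct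
    zeros \<open>0\<close>, \<open>1\<close>, \<open>a\<close> and infinity.\<close>
  obtain G :: "'a ^ 4 ^ 4" where
    "cone_weight G = (\<Sum>t\<in>UNIV. card {w. t * (a + (- (1 + a)) * t + 1 * t\<^sup>2 + 0 * w) \<noteq> 0})"
    by (rule cone_weight_example[of a "- (1 + a)" 1 0])
  also have "\<dots> = (\<Sum>t\<in>UNIV. card {w::'a. t \<notin> {0, 1, a}})"
  proof -
    have "a + (- (1 + a)) * t + 1 * t\<^sup>2 + 0 * w = (t - 1) * (t - a)" for t w
      by (simp add: power2_eq_square algebra_simps)
    then show ?thesis by simp
  qed
  also have "\<dots> = q * (q - 3)" using a q(1) by (subst sum_card_const) (simp add: numeral_3_eq_3)
  finally show ?A by (metis rangeI)
  \<comment> \<open>Here \<open>0\<close> is a double zero, leaving three distinct ones: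
    \<open>0\<close>, \<open>1\<close> and infinity.\<close>
  obtain G :: "'a ^ 4 ^ 4" where
    "cone_weight G = (\<Sum>t\<in>UNIV. card {w :: 'a. t * (0 + (- 1) * t + 1 * t\<^sup>2 + 0 * w) \<noteq> 0})"
    by (rule cone_weight_example[of 0 "- 1" 1 0])
  also have "\<dots> = (\<Sum>t\<in>UNIV. card {w::'a. t \<notin> {0, 1 :: 'a}})"
  proof -
    have "0 + (- 1) * t + 1 * t\<^sup>2 + 0 * w = t * (t - 1)" for t w :: 'a
      by (simp add: power2_eq_square algebra_simps)
    then show ?thesis by simp
  qed
  also have "\<dots> = q * (q - 2)" using q(1) by (subst sum_card_const) (simp add: numeral_2_eq_2)
  finally show ?B by (metis rangeI)
  \<comment> \<open>The product of \<open>x $ 2\<close> and \<open>x $ 4\<close> is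
    \<open>t * w\<close> on the cone: zero for \<open>t = 0\<close>, with a single zero on each line
    with \<open>t \<noteq> 0\<close>.\<close>
  obtain G :: "'a ^ 4 ^ 4" where
    "cone_weight G = (\<Sum>t\<in>UNIV. card {w :: 'a. t * (0 + 0 * t + 0 * t\<^sup>2 + 1 * w) \<noteq> 0})"
    by (rule cone_weight_example[of 0 0 0 1])
  also have "\<dots> = (\<Sum>t\<in>(UNIV :: 'a set). if t \<in> {0} then 0 else q - 1)"
  proof (intro sum.cong refl)
    fix t :: 'a
    show "card {w :: 'a. t * (0 + 0 * t + 0 * t\<^sup>2 + 1 * w) \<noteq> 0} = (if t \<in> {0} then 0 else q - 1)"
      using card_linear_nonzeros[of t 0] q(1) by simp
  qed
  also have "\<dots> = (q - 1)\<^sup>2"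
    unfolding sum.If_cases[OF finite] using q(1)
    by (simp add: Compl_eq_Diff_UNIV card_Diff_subset power2_eq_square)
  finally show ?C by (metis rangeI)
qed

section \<open>Distances and the theorem\<close>

text \<open>By linearity the difference of two codewords comes from the difference of their
  forms.\<close>

lemma hamming_dist_functional_code:
  assumes "u \<in> functional_code X" "v \<in> functional_code X"
  obtains w where "w \<in> functional_code X" "hamming_dist X u v = weight X w"
proof -
  obtain f g where fg: "f \<in> quadratic_forms" "g \<in> quadratic_forms"
    "u = restrict (form_eval f) X" "v = restrict (form_eval g) X"
    using assms by (auto simp: functional_code_def)
  have "form_eval (f - g) x = form_eval f x - form_eval g x" for x
    by (simp add: form_eval_def algebra_simps sum_subtractf)
  then have "hamming_dist X u v = weight X (restrict (form_eval (f - g)) X)"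
    unfolding hamming_dist_def weight_def fg by (intro arg_cong[of _ _ card]) auto
  moreover have "f - g \<in> quadratic_forms"
    using fg(1,2) by (simp add: quadratic_forms_def)
  ultimately show ?thesis using that unfolding functional_code_def by blast
qed

theorem theorem5p4:
  fixes X :: "('a::{field, finite} ^ 4) set" and q :: nat
  assumes "CARD('a) = q"
    and "q \<ge> 3"
    and "quadric_cone X"
  shows "(q > 3 \<longrightarrow> min_distance X (functional_code X) = q * (q - 3)) \<and>
         next_weight X (functional_code X) (q * (q - 3)) (q * (q - 2)) \<and>
         next_weight X (functional_code X) (q * (q - 2)) ((q - 1)\<^sup>2)"
proof -
  let ?C = "functional_code X" and ?W = "weight X ` functional_code X"
  note range = weights_functional_code[OF assms(3)]
  have mem: "q * (q - 3) \<in> ?W" "q * (q - 2) \<in> ?W" "(q - 1)\<^sup>2 \<in> ?W"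
    unfolding range using cone_weights_attained[OF assms(1,2)] by auto
  have cases: "n = 0 \<or> n = q * (q - 3) \<or> n = q * (q - 2) \<or> (q - 1)\<^sup>2 \<le> n" if "n \<in> ?W" for n
  proof -
    from that obtain G :: "'a ^ 4 ^ 4" where "n = cone_weight G" unfolding range by blast
    with cone_weight_cases[OF assms(1,2), of G] show ?thesis by simp
  qed
  obtain r where r: "q = r + 3" using assms(2) by (metis le_add_diff_inverse2)
  have less: "q * (q - 3) < q * (q - 2)" "q * (q - 2) < (q - 1)\<^sup>2"
    by (simp_all add: r power2_eq_square algebra_simps)
  have "next_weight X ?C (q * (q - 3)) (q * (q - 2))"
    unfolding next_weight_def using mem less cases by force
  moreover have "next_weight X ?C (q * (q - 2)) ((q - 1)\<^sup>2)"
    unfolding next_weight_def using mem less cases by force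
  moreover have "min_distance X ?C = q * (q - 3)" if "q > 3"
    unfolding min_distance_def
  proof (rule Least_equality)
    obtain u where u: "u \<in> ?C" "weight X u = q * (q - 3)" using mem(1) by auto
    define z :: "'a ^ 4 \<Rightarrow> 'a" where "z = restrict (form_eval 0) X"
    have "z \<in> ?C" by (auto simp: z_def functional_code_def quadratic_forms_def)
    moreover have "hamming_dist X u z = q * (q - 3)"
      unfolding u(2)[symmetric] hamming_dist_def weight_def
      by (intro arg_cong[of _ _ card]) (auto simp: z_def form_eval_def)
    \<comment> \<open>This is where \<open>q > 3\<close> enters: for \<open>q = 3\<close> the
      distance \<open>q * (q - 3)\<close> is \<open>0\<close>.\<close>
    moreover from this have "u \<noteq> z" using that by (auto simp: hamming_dist_def)
    ultimately show "\<exists>u\<in>?C. \<exists>v\<in>?C. u \<noteq> v \<and> hamming_dist X u v = q * (q - 3)"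
      using u(1) by blast
  next
    fix d assume "\<exists>u\<in>?C. \<exists>v\<in>?C. u \<noteq> v \<and> hamming_dist X u v = d"
    then obtain u v where uv: "u \<in> ?C" "v \<in> ?C" "u \<noteq> v" and d: "hamming_dist X u v = d" by blast
    \<comment> \<open>Codewords agree outside \<open>X\<close> because of \<open>restrict\<close>,
      so distinct ones differ at a point of \<open>X\<close>.\<close>
    have "{x \<in> X. u x \<noteq> v x} \<noteq> {}"
      using uv by (force simp: functional_code_def restrict_def)
    then have "d \<noteq> 0" by (simp add: hamming_dist_def flip: d)
    moreover have "d \<in> ?W"
      using hamming_dist_functional_code[OF uv(1,2)] d by (metis imageI)
    ultimately show "q * (q - 3) \<le> d" using cases[of d] less by linarith
  qed
  ultimately show ?thesis by blast
qed

end
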